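(* Let $n\in\mathbb{N}$, let $P$ be an $n\times n$ permutation matrix, and let $d$ be the number of fixed points of the corresponding permutation. Let $A=\frac{1}{2}(I_n+P)$. Then $A$ is an Erdős matrix, that is, $$\|A\|_{\mathrm{F}}^2=\frac{n+d}{2}=\mathrm{maxTrace}(A).$$ Furthermore, for $n\times n$ permutation matrices $P_1,P_2$, the families $\{I_n,P_1\}$ and $\{I_n,P_2\}$ are equivalent if and only if $P_1$ and $P_2$ are conjugates.
   Context: $I_n$ is the $n\times n$ identity matrix. A bistochastic matrix is a real square matrix with non-negative entries whose rows and columns each sum to $1$. $\|A\|_{\mathrm{F}}^2=\sum_{i,j=1}^{n}A_{i,j}^2$ is the squared Frobenius norm. The maximal trace of $A$ is $\mathrm{maxTrace}(A)=\max_{\sigma\in S_n}\sum_{i=1}^{n}A_{i,\sigma(i)}$, where $S_n$ is the set of permutations of $\{1,\ldots,n\}$. An $n\times n$ bistochastic matrix $A$ is an Erdős matrix if $\|A\|_{\mathrm{F}}^2=\mathrm{maxTrace}(A)$. Two families of $n\times n$ permutation matrices $\{P_1,\ldots,P_m\}$ and $\{Q_1,\ldots,Q_m\}$ are equivalent if there exist $n\times n$ permutation matrices $P,Q$ such that $\{PP_1Q,\ldots,PP_mQ\}=\{Q_1,\ldots,Q_m\}$. Conjugacy of permutation matrices means conjugacy in the group of $n\times n$ permutation matrices (equivalently, of the corresponding permutations in $S_n$). *)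

theory Defs
  imports "HOL-Analysis.Analysis"
begin

text \<open>
  Matrices of size n are elements of \<open>real ^ 'n ^ 'n\<close> with n = \<open>CARD('n)\<close>; permutations of the
  index set are functions \<open>\<sigma>\<close> with \<open>\<sigma> permutes UNIV\<close>.
\<close>

definition bistochastic :: "real ^ 'n ^ 'n \<Rightarrow> bool" where
  "bistochastic A \<longleftrightarrow>
     (\<forall>i j. 0 \<le> A $ i $ j) \<and>
     (\<forall>i. (\<Sum>j\<in>UNIV. A $ i $ j) = 1) \<and>
     (\<forall>j. (\<Sum>i\<in>UNIV. A $ i $ j) = 1)"

definition frobenius_sq :: "real ^ 'n ^ 'n \<Rightarrow> real" where
  "frobenius_sq A = (\<Sum>i\<in>UNIV. \<Sum>j\<in>UNIV. (A $ i $ j)\<^sup>2)"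

definition max_trace :: "real ^ 'n ^ 'n \<Rightarrow> real" where
  "max_trace A = (MAX \<sigma>\<in>{\<sigma>. \<sigma> permutes UNIV}. \<Sum>i\<in>UNIV. A $ i $ \<sigma> i)"

definition erdos_matrix :: "real ^ 'n ^ 'n \<Rightarrow> bool" where
  "erdos_matrix A \<longleftrightarrow> bistochastic A \<and> frobenius_sq A = max_trace A"

text \<open>
  The entry 1 in row \<open>i\<close> sits in column \<open>\<sigma> i\<close>. The other common convention replaces \<open>\<sigma>\<close> by its
  inverse, which has the same fixed points and preserves conjugacy.
\<close>

definition permutation_matrix :: "('n \<Rightarrow> 'n) \<Rightarrow> real ^ 'n ^ 'n" where
  "permutation_matrix \<sigma> = (\<chi> i j. if j = \<sigma> i then 1 else 0)"

definition is_permutation_matrix :: "real ^ 'n ^ 'n \<Rightarrow> bool" where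
  "is_permutation_matrix P \<longleftrightarrow> (\<exists>\<sigma>. \<sigma> permutes UNIV \<and> P = permutation_matrix \<sigma>)"

text \<open>Only meant for sets \<open>F\<close> and \<open>G\<close> of permutation matrices.\<close>

definition equivalent_families :: "(real ^ 'n ^ 'n) set \<Rightarrow> (real ^ 'n ^ 'n) set \<Rightarrow> bool" where
  "equivalent_families F G \<longleftrightarrow>
     (\<exists>P Q. is_permutation_matrix P \<and> is_permutation_matrix Q \<and> (\<lambda>R. P ** R ** Q) ` F = G)"

text \<open>
  Conjugacy in the group of permutation matrices, so the conjugating matrix is itself required to
  be a permutation matrix.
\<close>

definition conjugate_permutation_matrices :: "real ^ 'n ^ 'n \<Rightarrow> real ^ 'n ^ 'n \<Rightarrow> bool" where
  "conjugate_permutation_matrices P1 P2 \<longleftrightarrow>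
     (\<exists>Q. is_permutation_matrix Q \<and> P2 = Q ** P1 ** matrix_inv Q)"

end

theory Submission
  imports Defs "HOL-Combinatorics.Orbits"
begin

text \<open>
  In row \<open>i\<close> of \<open>A = (I + P) / 2\<close> the non-zero entries are two copies of \<open>1/2\<close> in the columns \<open>i\<close>
  and \<open>\<sigma> i\<close>, or a single \<open>1\<close> if \<open>\<sigma> i = i\<close>. So the sum of squares of the row equals its diagonal
  entry, and this entry is also the maximum of the row. Summing over the rows, the Frobenius norm
  squared is the trace of \<open>A\<close>, and no permutation does better than the identity in the maximal
  trace (\<open>half_sum_row\<close>).

  For the second part, write everything in terms of permutations. If multiplication by \<open>P\<close> and \<open>Q\<close>
  sends the family of \<open>I\<close> and \<open>P1\<close> to that of \<open>I\<close> and \<open>P2\<close>, there are two cases. Either \<open>I\<close> is sent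
  to \<open>I\<close>; then \<open>Q\<close> is the inverse of \<open>P\<close>, and \<open>P1\<close> is sent to a conjugate of itself. Or the two members
  are swapped, which yields that \<open>P2\<close> is conjugate to the inverse of \<open>P1\<close>. The key to the
  second case is that a permutation of a finite set is always conjugate to its own inverse
  (\<open>conjugate_to_inverse\<close>): reflect every cycle about one of its points.
\<close>

section \<open>Permutations are conjugate to their inverses\<close>

text \<open>
  Apply the inverse of \<open>f\<close> to both sides \<open>k + l\<close> times. For the reflection \<open>f\<^sup>k r \<mapsto> f\<^sup>-\<^sup>k r\<close> of the
  cycle through \<open>r\<close> this gives well-definedness and, with the inverse of \<open>f\<close> in place of \<open>f\<close>,
  injectivity.
\<close>

lemma funpow_eq_imp_inv_funpow_eq:
  assumes "bij f" and "(f ^^ k) x = (f ^^ l) x"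
  shows "(inv f ^^ k) x = (inv f ^^ l) x"
proof -
  have cancel: "(inv f ^^ m) ((f ^^ m) z) = z" for m z
    using assms(1) by (simp add: bij_is_inj inv_fn[symmetric] bij_fn)
  have "(inv f ^^ l) x = (inv f ^^ (l + k)) ((f ^^ k) x)"
    by (simp add: funpow_add cancel)
  also have "\<dots> = (inv f ^^ (k + l)) ((f ^^ l) x)"
    by (simp only: assms(2) add.commute)
  also have "\<dots> = (inv f ^^ k) x"
    by (simp add: funpow_add cancel)
  finally show ?thesis ..
qed

text \<open>
  Choose a base point \<open>r\<close> in each orbit and map \<open>f\<^sup>k r\<close> to \<open>f\<^sup>-\<^sup>k r\<close>. This reflection turns each
  step of \<open>f\<close> into a step backwards, so it conjugates \<open>f\<close> to its inverse.
\<close>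

lemma conjugate_to_inverse:
  fixes f :: "'a::finite \<Rightarrow> 'a"
  assumes "bij f"
  obtains t where "bij t" and "inv f = t \<circ> f \<circ> inv t"
proof -
  have perm: "permutation f"
    using assms by (simp add: permutation)
  define r where "r x = (SOME y. y \<in> orbit f x)" for x
  define k where "k x = (SOME k. x = (f ^^ k) (r x))" for x
  define t where "t x = (inv f ^^ k x) (r x)" for x
  have r_orbit: "r x \<in> orbit f x" for x
    unfolding r_def by (rule someI, rule permutation_self_in_orbit[OF perm])
  \<comment> \<open>The base point depends only on the orbit, since \<open>orbit f x\<close> is the same set for all its points.\<close>
  have r_cong: "r y = r x" if "y \<in> orbit f x" for x y
    using orbit_cyclic_eq3[OF cyclic_on_orbit'[OF perm] that]
    by (simp add: r_def)
  have "\<exists>m. x = (f ^^ m) (r x)" for x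
  proof -
    have "x \<in> orbit f (r x)"
      using r_orbit[of x] permutation_self_in_orbit[OF perm, of x]
        orbit_cyclic_eq3[OF cyclic_on_orbit'[OF perm] r_orbit[of x]] by simp
    then show ?thesis by (auto simp: orbit_altdef)
  qed
  then have k: "x = (f ^^ k x) (r x)" for x
    unfolding k_def by (rule someI_ex)
  have t_eq: "t x = (inv f ^^ m) (r x)" if "x = (f ^^ m) (r x)" for x m
    using funpow_eq_imp_inv_funpow_eq[OF assms] k[of x] that unfolding t_def by metis
  have step: "t (f x) = inv f (t x)" for x
  proof -
    have "r (f x) = r x"
      by (rule r_cong) (rule orbit.base)
    then have "t (f x) = (inv f ^^ Suc (k x)) (r x)"
      using t_eq[of "f x" "Suc (k x)"] k[of x] by simp
    then show ?thesis by (simp add: t_def)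
  qed
  have t_orbit: "r (t x) = r x" for x
  proof -
    have r_inv: "r (inv f y) = r y" for y
      using r_cong[of y "inv f y"] orbit.base[of f "inv f y"] assms
      by (simp add: bij_is_surj surj_f_inv_f)
    have "r ((inv f ^^ m) y) = r y" for m y
      by (induction m) (simp_all add: r_inv)
    then show ?thesis
      using r_cong[OF r_orbit] by (simp add: t_def)
  qed
  have "inj t"
  proof (rule injI)
    fix x y assume eq: "t x = t y"
    then have r: "r x = r y" by (metis t_orbit)
    have "(inv (inv f) ^^ k x) (r x) = (inv (inv f) ^^ k y) (r x)"
      using eq r by (intro funpow_eq_imp_inv_funpow_eq[OF bij_imp_bij_inv[OF assms]])
        (simp add: t_def)
    then have "(f ^^ k x) (r x) = (f ^^ k y) (r y)"
      using r assms by (simp add: inv_inv_eq)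
    then show "x = y"
      using k[of x] k[of y] by simp
  qed
  then have bij: "bij t"
    by (simp add: bij_def finite_UNIV_inj_surj)
  moreover have "inv f = t \<circ> f \<circ> inv t"
    using bij by (simp add: fun_eq_iff step bij_is_surj surj_f_inv_f)
  ultimately show ?thesis by (rule that)
qed

section \<open>Permutation matrices\<close>

lemma permutes_UNIV_iff_bij: "f permutes UNIV \<longleftrightarrow> bij f"
  by (auto intro: permutes_bij bij_imp_permutes)

text \<open>
  Row \<open>i\<close> of the product picks row \<open>f i\<close> of the second factor, whose 1 is in column \<open>g (f i)\<close>: the
  order of the factors is reversed.
\<close>

lemma permutation_matrix_mult:
  "permutation_matrix f ** permutation_matrix g = permutation_matrix (g \<circ> f)"
proof -
  have "(\<Sum>k\<in>UNIV. (if k = f i then 1 else 0) * (if j = g k then 1 else (0::real))) =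
      (\<Sum>k\<in>UNIV. if k = f i then if j = g k then 1 else 0 else 0)" for i j
    by (rule sum.cong) auto
  then show ?thesis
    by (simp add: permutation_matrix_def matrix_matrix_mult_def vec_eq_iff)
qed

lemma permutation_matrix_id: "permutation_matrix id = mat 1"
  by (simp add: permutation_matrix_def mat_def vec_eq_iff eq_commute)

lemma permutation_matrix_eq_iff: "permutation_matrix f = permutation_matrix g \<longleftrightarrow> f = g"
proof
  assume "permutation_matrix f = permutation_matrix g"
  then have "permutation_matrix f $ i $ f i = permutation_matrix g $ i $ f i" for i
    by simp
  then show "f = g"
    by (simp add: permutation_matrix_def fun_eq_iff) (metis zero_neq_one)
qed simp

lemma matrix_inv_permutation_matrix:
  assumes "bij f"
  shows "matrix_inv (permutation_matrix f) = permutation_matrix (inv f)"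
proof -
  let ?A = "permutation_matrix f" and ?B = "permutation_matrix (inv f)"
  have inverse: "?A ** ?B = mat 1" "?B ** ?A = mat 1"
    using bij_is_inj[OF assms] bij_is_surj[OF assms]
    by (simp_all add: permutation_matrix_mult permutation_matrix_id[symmetric] surj_iff inj_iff)
  have "?A ** matrix_inv ?A = mat 1"
    unfolding matrix_inv_def by (rule someI2[where a = ?B]) (use inverse in auto)
  then have "?B ** (?A ** matrix_inv ?A) = ?B"
    by simp
  then show ?thesis
    by (simp add: matrix_mul_assoc inverse(2))
qed

lemma conjugate_permutation_matrices_iff:
  "conjugate_permutation_matrices (permutation_matrix f) (permutation_matrix g) \<longleftrightarrow>
    (\<exists>q. bij q \<and> g = inv q \<circ> f \<circ> q)"
  unfolding conjugate_permutation_matrices_def is_permutation_matrix_def permutes_UNIV_iff_bij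
  by (auto simp: matrix_inv_permutation_matrix permutation_matrix_mult permutation_matrix_eq_iff
      comp_assoc)

lemma equivalent_families_iff:
  "equivalent_families {mat 1, permutation_matrix f} {mat 1, permutation_matrix g} \<longleftrightarrow>
    (\<exists>p q. bij p \<and> bij q \<and> {q \<circ> p, q \<circ> f \<circ> p} = {id, g})"
proof -
  have "(\<lambda>R. permutation_matrix p ** R ** permutation_matrix q) ` {mat 1, permutation_matrix f}
      = {mat 1, permutation_matrix g} \<longleftrightarrow> {q \<circ> p, q \<circ> f \<circ> p} = {id, g}" for p q
    by (simp add: permutation_matrix_id[symmetric] permutation_matrix_mult doubleton_eq_iff
        permutation_matrix_eq_iff comp_assoc)
  then show ?thesis
    unfolding equivalent_families_def is_permutation_matrix_def permutes_UNIV_iff_bij by blast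
qed

section \<open>Equivalence of families and conjugacy\<close>

lemma doubleton_with_id_iff_conjugate:
  fixes f g :: "'a::finite \<Rightarrow> 'a"
  assumes f: "bij f"
  shows "(\<exists>p q. bij p \<and> bij q \<and> {q \<circ> p, q \<circ> f \<circ> p} = {id, g}) \<longleftrightarrow>
    (\<exists>q. bij q \<and> g = inv q \<circ> f \<circ> q)"
proof
  assume "\<exists>p q. bij p \<and> bij q \<and> {q \<circ> p, q \<circ> f \<circ> p} = {id, g}"
  then obtain p q where p: "bij p" and q: "bij q" and eq: "{q \<circ> p, q \<circ> f \<circ> p} = {id, g}"
    by blast
  from eq consider "q \<circ> p = id" "g = q \<circ> f \<circ> p" | "q \<circ> p = g" "q \<circ> f \<circ> p = id"
    by (auto simp: doubleton_eq_iff)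
  then show "\<exists>q. bij q \<and> g = inv q \<circ> f \<circ> q"
  proof cases
    case 1
    have "q = inv p"
      using p 1(1) by (metis bij_is_surj comp_assoc comp_id id_comp surj_iff)
    with p 1(2) show ?thesis by blast
  next
    case 2
    \<comment> \<open>Here \<open>f\<close> is the inverse of \<open>p \<circ> q\<close>, while \<open>g = q \<circ> p\<close> is conjugate to \<open>p \<circ> q\<close>.\<close>
    obtain t where t: "bij t" and inv_f: "inv f = t \<circ> f \<circ> inv t"
      using conjugate_to_inverse[OF f] .
    have f_pq: "f (p (q x)) = x" for x
    proof -
      have "q (f (p (q x))) = q x"
        using 2(2) by (simp add: fun_eq_iff)
      then show ?thesis using q by (simp add: bij_is_inj inj_eq)
    qed
    have "p (q x) = t (f (inv t x))" for x
    proof -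
      have "p (q x) = inv f x"
        using f_pq[of x] f by (metis bij_is_inj inv_f_f)
      then show ?thesis by (simp add: inv_f)
    qed
    then have "g x = inv p (t (f (inv t (p x))))" for x
      using 2(1) p by (metis bij_is_inj comp_apply inv_f_f)
    then have "g = inv (inv t \<circ> p) \<circ> f \<circ> (inv t \<circ> p)"
      using p t by (simp add: fun_eq_iff o_inv_distrib bij_imp_bij_inv inv_inv_eq)
    then show ?thesis
      using p t by (blast intro: bij_comp bij_imp_bij_inv)
  qed
next
  assume "\<exists>q. bij q \<and> g = inv q \<circ> f \<circ> q"
  then obtain q where q: "bij q" "g = inv q \<circ> f \<circ> q" by blast
  then have "{inv q \<circ> q, inv q \<circ> f \<circ> q} = {id, g}"
    by (simp add: bij_is_inj)
  with q(1) show "\<exists>p q. bij p \<and> bij q \<and> {q \<circ> p, q \<circ> f \<circ> p} = {id, g}"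
    using bij_imp_bij_inv by blast
qed

section \<open>The average of the identity and a permutation matrix\<close>

lemma half_sum_entry:
  "((1/2) *\<^sub>R (mat 1 + permutation_matrix f)) $ i $ j =
    (of_bool (j = i) + of_bool (j = f i)) / 2"
  by (auto simp: mat_def permutation_matrix_def)

lemma bistochastic_half_sum:
  fixes f :: "'n::finite \<Rightarrow> 'n"
  assumes "bij f"
  shows "bistochastic ((1/2) *\<^sub>R (mat 1 + permutation_matrix f))"
proof -
  have "(\<Sum>i\<in>UNIV. of_bool (j = f i) :: real) = (\<Sum>i\<in>UNIV. of_bool (j = i))" for j
    by (rule sum.reindex_bij_betw[OF assms])
  then show ?thesis
    unfolding bistochastic_def half_sum_entry sum_divide_distrib[symmetric] sum.distrib
    by (simp only:) (simp add: of_bool_def)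
qed

text \<open>
  If \<open>f\<close> moves \<open>i\<close>, the two entries \<open>1/2\<close> have squares adding up to \<open>1/2\<close>; if \<open>f\<close> fixes \<open>i\<close>,
  the only non-zero entry is the \<open>1\<close> on the diagonal.
\<close>

lemma half_sum_row:
  fixes f :: "'n::finite \<Rightarrow> 'n"
  defines "A \<equiv> (1/2) *\<^sub>R (mat 1 + permutation_matrix f)"
  shows "(\<Sum>j\<in>UNIV. (A $ i $ j)\<^sup>2) = A $ i $ i" and "A $ i $ j \<le> A $ i $ i"
proof -
  \<comment> \<open>The square is expanded; the cross term survives only at a fixed point.\<close>
  have "(A $ i $ j)\<^sup>2 = of_bool (j = i) / 4 + of_bool (j = f i) / 4
      + of_bool (j = i) * (of_bool (f i = i) / 2)" for j
    unfolding A_def half_sum_entry by (auto simp: power2_eq_square)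
  then show "(\<Sum>j\<in>UNIV. (A $ i $ j)\<^sup>2) = A $ i $ i"
    unfolding A_def half_sum_entry
    by (simp add: sum.distrib sum_divide_distrib[symmetric] sum_distrib_right[symmetric]
        of_bool_def)
  show "A $ i $ j \<le> A $ i $ i"
    unfolding A_def half_sum_entry by auto
qed

lemma trace_half_sum:
  fixes f :: "'n::finite \<Rightarrow> 'n"
  shows "(\<Sum>i\<in>UNIV. ((1/2) *\<^sub>R (mat 1 + permutation_matrix f)) $ i $ i) =
    (real CARD('n) + real (card {i. f i = i})) / 2"
  unfolding half_sum_entry
  by (simp add: sum_divide_distrib[symmetric] sum.distrib of_bool_def sum.If_cases eq_commute)

lemma max_trace_eq_trace_if_diagonal_dominates:
  fixes A :: "real ^ 'n ^ 'n"
  assumes "\<And>i j. A $ i $ j \<le> A $ i $ i"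
  shows "max_trace A = (\<Sum>i\<in>UNIV. A $ i $ i)"
  unfolding max_trace_def
proof (rule Max_eqI)
  show "(\<Sum>i\<in>UNIV. A $ i $ i) \<in> (\<lambda>\<sigma>. \<Sum>i\<in>UNIV. A $ i $ \<sigma> i) ` {\<sigma>. \<sigma> permutes UNIV}"
    by (rule image_eqI[where x = id]) (simp_all add: permutes_id)
qed (auto intro: sum_mono assms)

theorem proposition4p3:
  fixes \<sigma> :: "'n::finite \<Rightarrow> 'n"
    and P A :: "real ^ 'n ^ 'n"
    and d :: nat
  assumes "\<sigma> permutes UNIV"
    and "P = permutation_matrix \<sigma>"
    and "d = card {i. \<sigma> i = i}"
    and "A = (1/2) *\<^sub>R (mat 1 + P)"
  shows "erdos_matrix A
       \<and> frobenius_sq A = (real CARD('n) + real d) / 2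
       \<and> (real CARD('n) + real d) / 2 = max_trace A
       \<and> (\<forall>P1 P2 :: real ^ 'n ^ 'n.
            is_permutation_matrix P1 \<longrightarrow> is_permutation_matrix P2 \<longrightarrow>
            (equivalent_families {mat 1, P1} {mat 1, P2}
               \<longleftrightarrow> conjugate_permutation_matrices P1 P2))"
proof -
  have A: "A = (1/2) *\<^sub>R (mat 1 + permutation_matrix \<sigma>)"
    using assms by simp
  have trace: "(\<Sum>i\<in>UNIV. A $ i $ i) = (real CARD('n) + real d) / 2"
    unfolding A assms(3) by (rule trace_half_sum)
  have frob: "frobenius_sq A = (real CARD('n) + real d) / 2"
    unfolding trace[symmetric] frobenius_sq_def A by (simp only: half_sum_row(1))
  have max: "max_trace A = (real CARD('n) + real d) / 2"
    unfolding trace[symmetric]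
    by (rule max_trace_eq_trace_if_diagonal_dominates) (unfold A, rule half_sum_row(2))
  have "bistochastic A"
    unfolding A using assms(1) by (intro bistochastic_half_sum permutes_bij)
  then have "erdos_matrix A"
    by (simp add: erdos_matrix_def frob max)
  moreover have "equivalent_families {mat 1, P1} {mat 1, P2}
      \<longleftrightarrow> conjugate_permutation_matrices P1 P2"
    if P1_P2: "is_permutation_matrix P1" "is_permutation_matrix P2" for P1 P2 :: "real ^ 'n ^ 'n"
  proof -
    obtain f g where "bij f" "P1 = permutation_matrix f" "P2 = permutation_matrix g"
      using P1_P2 unfolding is_permutation_matrix_def permutes_UNIV_iff_bij by blast
    then show ?thesis
      by (simp only: equivalent_families_iff conjugate_permutation_matrices_iff
          doubleton_with_id_iff_conjugate)
  qed
  ultimately show ?thesis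
    using frob max by simp
qed

end
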